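(* Let $k\ge2$, $\mathcal{A}_k=\{1,\dots,k\}$, and let $X$ be an Arnoux-Rauzy subshift over $\mathcal{A}_k$. Then the palindrome complexity function $p:\mathbb{N}\to\mathbb{N}_0$ of $X$ is given by $$p(n)=\begin{cases} k & \text{if } n \text{ is odd},\\ 1 & \text{if } n\text{ is even}.\end{cases}$$
   Context: $\mathbb{N}=\{1,2,\dots\}$, $\mathbb{N}_0=\mathbb{N}\cup\{0\}$. For $x\in\mathcal{A}_k^{\mathbb{N}}$ or $\mathcal{A}_k^{\mathbb{Z}}$, $F_x(n)$ is the set of factors (contiguous subwords) of $x$ of length $n$, and $F_x=\bigcup_n F_x(n)$. A factor $u$ is right-special if there are letters $a\ne b$ with $ua,ub\in F_x$; left-special if there are $a\neq b$ with $au,bu\in F_x$. The sequence $x$ is an Arnoux-Rauzy (AR) sequence if (1) $x$ is uniformly recurrent (each factor occurs with bounded gaps), (2) $|F_x(n)|=(k-1)n+1$ for all $n\in\mathbb{N}$, and (3) for each $n$, $F_x(n)$ contains exactly one right-special factor and exactly one left-special factor. The associated AR subshift is $X=\{y\in\mathcal{A}_k^{\mathbb{N}} \text{ (or } \mathcal{A}_k^{\mathbb{Z}}) : F_y(n)=F_x(n)\ \forall n\in\mathbb{N}\}$; all its elements have the same factors, and one writes $F_X$ for $F_x$. The reversal of $u=u_1\cdots u_m$ is $u^R=u_m\cdots u_1$; $u$ is a palindrome if $u=u^R$. The palindrome complexity function of $X$ is $p(n)=|\{u\in F_X: u=u^R,\ |u|=n\}|$. *)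

theory Defs
  imports Main
begin

text \<open>
  A sequence is a function on positions of type \<open>'i\<close>. Only the instances \<open>'i = nat\<close> (one-sided
  sequences, with positions numbered from 0 instead of 1) and \<open>'i = int\<close> (two-sided sequences)
  are intended; the class \<open>semiring_1\<close> just provides \<open>i + of_nat j\<close> for both.
\<close>

definition alphabet :: "nat \<Rightarrow> nat set" where
  "alphabet k = {1..k}"

definition sequences :: "nat \<Rightarrow> ('i \<Rightarrow> nat) set" where
  "sequences k = {x. \<forall>i. x i \<in> alphabet k}"

definition factor_at :: "('i::semiring_1 \<Rightarrow> nat) \<Rightarrow> 'i \<Rightarrow> nat \<Rightarrow> nat list" where
  "factor_at x i n = map (\<lambda>j. x (i + of_nat j)) [0..<n]"

definition factors_of_length :: "('i::semiring_1 \<Rightarrow> nat) \<Rightarrow> nat \<Rightarrow> nat list set" where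
  "factors_of_length x n = range (\<lambda>i. factor_at x i n)"

text \<open>Lengths range over the positive integers, so the empty word is not in \<open>factors x\<close>.\<close>

definition factors :: "('i::semiring_1 \<Rightarrow> nat) \<Rightarrow> nat list set" where
  "factors x = (\<Union>n\<in>{1..}. factors_of_length x n)"

definition right_special :: "('i::semiring_1 \<Rightarrow> nat) \<Rightarrow> nat list \<Rightarrow> bool" where
  "right_special x u \<longleftrightarrow>
     u \<in> factors x \<and> (\<exists>a b. a \<noteq> b \<and> u @ [a] \<in> factors x \<and> u @ [b] \<in> factors x)"

definition left_special :: "('i::semiring_1 \<Rightarrow> nat) \<Rightarrow> nat list \<Rightarrow> bool" where
  "left_special x u \<longleftrightarrow>
     u \<in> factors x \<and> (\<exists>a b. a \<noteq> b \<and> a # u \<in> factors x \<and> b # u \<in> factors x)"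

text \<open>Bounded gaps: some \<open>L\<close> such that every \<open>L\<close> consecutive positions include a start of \<open>u\<close>.\<close>

definition uniformly_recurrent :: "('i::semiring_1 \<Rightarrow> nat) \<Rightarrow> bool" where
  "uniformly_recurrent x \<longleftrightarrow>
     (\<forall>u\<in>factors x. \<exists>L. \<forall>i. \<exists>j<L. factor_at x (i + of_nat j) (length u) = u)"

definition AR_sequence :: "nat \<Rightarrow> ('i::semiring_1 \<Rightarrow> nat) \<Rightarrow> bool" where
  "AR_sequence k x \<longleftrightarrow>
     x \<in> sequences k \<and>
     uniformly_recurrent x \<and>
     (\<forall>n\<ge>1. card (factors_of_length x n) = (k - 1) * n + 1) \<and>
     (\<forall>n\<ge>1. (\<exists>!u. u \<in> factors_of_length x n \<and> right_special x u) \<and>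
             (\<exists>!u. u \<in> factors_of_length x n \<and> left_special x u))"

definition AR_subshift :: "nat \<Rightarrow> ('i::semiring_1 \<Rightarrow> nat) set \<Rightarrow> bool" where
  "AR_subshift k X \<longleftrightarrow>
     (\<exists>x :: 'i \<Rightarrow> nat. AR_sequence k x \<and>
          X = {y \<in> sequences k. \<forall>n\<ge>1. factors_of_length y n = factors_of_length x n})"

text \<open>
  For an AR subshift all members have the same factors, so this union is the common
  factor set of the members.
\<close>

definition subshift_factors :: "('i::semiring_1 \<Rightarrow> nat) set \<Rightarrow> nat list set" where
  "subshift_factors X = (\<Union>x\<in>X. factors x)"

definition palindrome :: "nat list \<Rightarrow> bool" where
  "palindrome u \<longleftrightarrow> u = rev u"

definition palindrome_complexity :: "('i::semiring_1 \<Rightarrow> nat) set \<Rightarrow> nat \<Rightarrow> nat" where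
  "palindrome_complexity X n = card {u \<in> subshift_factors X. palindrome u \<and> length u = n}"

end

theory Submission
  imports Defs
begin

text \<open>
  Write \<open>L n\<close> for the factors of length \<open>n\<close>. Since \<open>card (L (n + 1)) - card (L n) = k - 1\<close> and
  only one word of each length branches to the right, that word has all \<open>k\<close> letters as right
  extensions; the same holds on the left.

  By induction on \<open>m\<close>, the set \<open>L (m + 1)\<close> is closed under reversal, and the numbers of
  palindromes of lengths \<open>m\<close> and \<open>m + 1\<close> are \<open>1\<close> and \<open>k\<close>, in one order or the other. The words
  \<open>a u b\<close> of length \<open>m + 2\<close> are determined by those of length \<open>m + 1\<close> unless \<open>u\<close> is both left and
  right special. Such a \<open>u = w\<close> is a palindrome, since reversal exchanges the two special words;
  if \<open>a0 w\<close> is the right special and \<open>w b0\<close> the left special word of length \<open>m + 1\<close>, then \<open>a w b\<close>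
  is a factor exactly if \<open>a = a0\<close> or \<open>b = b0\<close>. So if \<open>a0 = b0\<close>, then \<open>L (m + 2)\<close> is again closed
  under reversal, and each palindrome \<open>u\<close> of length \<open>m\<close> has exactly one palindromic extension
  \<open>a u a\<close>: the two palindrome counts are carried on to the next pair of lengths.

  The crux is \<open>a0 = b0\<close> (\<open>bispecial_ends_agree\<close>). In the Rauzy graph with vertices \<open>L m\<close> and
  edges \<open>L (m + 1)\<close>, all branching happens at \<open>w\<close>, so the graph is a bouquet of \<open>k\<close> circuits at
  \<open>w\<close>, one for each letter that follows \<open>w\<close>. Reversal permutes the circuits. Growing a palindrome
  \<open>v \<noteq> w\<close> of length \<open>m\<close> or \<open>m + 1\<close> symmetrically until \<open>w\<close> is met makes it the centre of a circuit
  that is its own reversal (\<open>palindrome_centre_of_return_path\<close>), and a circuit has only one centre.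
  There are \<open>1 + k - 1 = k\<close> such \<open>v\<close>, so all \<open>k\<close> circuits are palindromic. In particular the
  circuit that leaves \<open>w\<close> by \<open>b0\<close> comes back with \<open>b0\<close> in front of \<open>w\<close>. If \<open>a0 \<noteq> b0\<close>, then
  \<open>b0 w\<close> can only be followed by \<open>b0\<close>, so the sequence runs through this circuit forever, and
  \<open>a0 w\<close> does not recur.

  Everything depends on the language of the sequence only, and by recurrence the language is
  already visible on the positions \<open>0, 1, 2, \<dots>\<close>; this reduces two-sided sequences to one-sided
  ones.
\<close>

section \<open>Words read along a sequence\<close>

lemma length_factor_at [simp]: "length (factor_at x i n) = n"
  by (simp add: factor_at_def)

lemma factor_at_nth [simp]: "j < n \<Longrightarrow> factor_at x i n ! j = x (i + of_nat j)"
  by (simp add: factor_at_def)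

lemma factor_at_0 [simp]: "factor_at x i 0 = []"
  by (simp add: factor_at_def)

lemma factor_at_snoc: "factor_at x i (Suc n) = factor_at x i n @ [x (i + of_nat n)]"
  by (simp add: factor_at_def)

lemma factor_at_Cons:
  fixes x :: "nat \<Rightarrow> nat"
  shows "factor_at x i (Suc n) = x i # factor_at x (Suc i) n"
  by (rule nth_equalityI) (auto simp: nth_Cons split: nat.splits)

lemma take_drop_factor_at:
  fixes x :: "nat \<Rightarrow> nat"
  shows "s + c \<le> n \<Longrightarrow> take c (drop s (factor_at x i n)) = factor_at x (i + s) c"
  by (rule nth_equalityI) (auto simp: add.assoc)

lemma factor_at_add:
  fixes x :: "nat \<Rightarrow> nat"
  shows "factor_at x i (p + q) = factor_at x i p @ factor_at x (i + p) q"
  by (rule nth_equalityI) (auto simp: nth_append)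

lemma take_drop_rev:
  assumes "s + c \<le> length z"
  shows "take c (drop s (rev z)) = rev (take c (drop (length z - s - c) z))"
  using assms by (intro nth_equalityI) (auto simp: rev_nth intro!: arg_cong[where f = "nth z"])

text \<open>
  In the application \<open>E u\<close> is the set of letters that extend \<open>u\<close>, and \<open>d = k - 1\<close> is the growth
  of the complexity: a single branching word has to absorb all of it.
\<close>

lemma card_branching_point:
  assumes fin: "finite S" and r: "r \<in> S"
    and one: "\<And>u. u \<in> S \<Longrightarrow> u \<noteq> r \<Longrightarrow> card (E u) = 1"
    and total: "(\<Sum>u\<in>S. card (E u)) = card S + d"
  shows "card (E r) = Suc d"
proof -
  have "(\<Sum>u\<in>S - {r}. card (E u)) = card (S - {r})"
    using one by simp
  moreover have "(\<Sum>u\<in>S. card (E u)) = card (E r) + (\<Sum>u\<in>S - {r}. card (E u))"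
    by (rule sum.remove[OF fin r])
  moreover have "card S = Suc (card (S - {r}))"
    using fin r by (rule card.remove)
  ultimately show ?thesis using total by simp
qed

section \<open>Special factors of an Arnoux-Rauzy sequence\<close>

locale arnoux_rauzy =
  fixes x :: "nat \<Rightarrow> nat" and k :: nat
  assumes k2: "2 \<le> k" and AR: "AR_sequence k x"
begin

abbreviation "W \<equiv> factor_at x"
abbreviation "L \<equiv> factors_of_length x"

definition right_exts :: "nat list \<Rightarrow> nat set" where
  "right_exts u = {a. u @ [a] \<in> L (Suc (length u))}"

definition left_exts :: "nat list \<Rightarrow> nat set" where
  "left_exts u = {a. a # u \<in> L (Suc (length u))}"

lemma W_in_L [simp]: "W i n \<in> L n"
  by (auto simp: factors_of_length_def)

lemma L_length: "u \<in> L n \<Longrightarrow> length u = n"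
  by (auto simp: factors_of_length_def)

lemma letter: "x i \<in> {1..k}"
  using AR by (auto simp: AR_sequence_def sequences_def alphabet_def)

lemma letters_of_factor: "u \<in> L n \<Longrightarrow> set u \<subseteq> {1..k}"
  using letter by (auto simp: factors_of_length_def factor_at_def simp del: atLeastAtMost_iff)

lemma L_0 [simp]: "L 0 = {[]}"
  by (auto simp: factors_of_length_def)

lemma card_L: "card (L n) = (k - 1) * n + 1"
  using AR by (cases "n = 0") (auto simp: AR_sequence_def)

lemma finite_L [simp]: "finite (L n)"
  using card_L[of n] card.infinite by fastforce

lemma in_factors_iff: "u \<noteq> [] \<Longrightarrow> u \<in> factors x \<longleftrightarrow> u \<in> L (length u)"
  by (auto simp: factors_def factors_of_length_def Suc_le_eq)

lemma recurrent:
  assumes "u \<in> L n"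
  obtains j where "i \<le> j" "W j n = u"
proof (cases "n = 0")
  case True
  then show ?thesis using assms that[of i] by simp
next
  case False
  then have "u \<in> factors x" "length u = n"
    using assms L_length by (auto simp: factors_def Suc_le_eq)
  then obtain j where "W (i + of_nat j) n = u"
    using AR unfolding AR_sequence_def uniformly_recurrent_def by blast
  then show ?thesis using that[of "i + j"] by simp
qed

lemma L_snocD: "u @ [a] \<in> L (Suc n) \<Longrightarrow> u \<in> L n"
  by (auto simp: factors_of_length_def factor_at_snoc)

lemma L_ConsD: "a # u \<in> L (Suc n) \<Longrightarrow> u \<in> L n"
  by (auto simp: factors_of_length_def factor_at_Cons)

lemma right_exts_subset: "right_exts u \<subseteq> {1..k}"
  using letters_of_factor by (fastforce simp: right_exts_def)

lemma left_exts_subset: "left_exts u \<subseteq> {1..k}"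
  using letters_of_factor by (fastforce simp: left_exts_def)

lemma right_exts_nonempty: "u \<in> L n \<Longrightarrow> right_exts u \<noteq> {}"
proof -
  assume u: "u \<in> L n"
  then obtain i where i: "W i n = u" by (rule recurrent)
  have "u @ [x (i + n)] \<in> L (Suc n)"
    using W_in_L[of i "Suc n"] unfolding factor_at_snoc i by simp
  then show ?thesis using L_length[OF u] by (auto simp: right_exts_def)
qed

text \<open>
  An occurrence at a positive position is needed here, because position 0 of a one-sided sequence
  has no predecessor.
\<close>

lemma left_exts_nonempty: "u \<in> L n \<Longrightarrow> left_exts u \<noteq> {}"
proof -
  assume u: "u \<in> L n"
  then obtain i where i: "1 \<le> i" "W i n = u" by (rule recurrent)
  have "x (i - 1) # u \<in> L (Suc n)"
    using W_in_L[of "i - 1" "Suc n"] i unfolding factor_at_Cons by simp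
  then show ?thesis using L_length[OF u] by (auto simp: left_exts_def)
qed

text \<open>
  Both sides count \<open>L (n + 1)\<close>: on the left by deleting the last letter, on the right by the
  complexity formula.
\<close>

lemma sum_card_right_exts: "(\<Sum>u\<in>L n. card (right_exts u)) = card (L n) + (k - 1)"
proof -
  have "L (Suc n) = (\<lambda>(u, a). u @ [a]) ` Sigma (L n) right_exts" (is "_ = ?f ` ?S")
  proof (intro equalityI subsetI)
    fix v assume v: "v \<in> L (Suc n)"
    then obtain u a where ua: "v = u @ [a]"
      using L_length by (metis length_Suc_conv_rev)
    then have "(u, a) \<in> ?S"
      using v L_snocD[of u a n] L_length by (auto simp: right_exts_def)
    then show "v \<in> ?f ` ?S" using ua by force
  qed (auto simp: right_exts_def dest: L_length)
  moreover have "inj_on ?f ?S" by (auto simp: inj_on_def)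
  ultimately have "card (L (Suc n)) = card ?S" by (simp add: card_image)
  also have "\<dots> = (\<Sum>u\<in>L n. card (right_exts u))"
    by (intro card_SigmaI) (auto intro: finite_subset[OF right_exts_subset])
  finally show ?thesis by (simp add: card_L)
qed

lemma sum_card_left_exts: "(\<Sum>u\<in>L n. card (left_exts u)) = card (L n) + (k - 1)"
proof -
  have "L (Suc n) = (\<lambda>(u, a). a # u) ` Sigma (L n) left_exts" (is "_ = ?f ` ?S")
  proof (intro equalityI subsetI)
    fix v assume v: "v \<in> L (Suc n)"
    then obtain u a where ua: "v = a # u"
      using L_length by (metis length_Suc_conv)
    then have "(u, a) \<in> ?S"
      using v L_ConsD[of a u n] L_length by (auto simp: left_exts_def)
    then show "v \<in> ?f ` ?S" using ua by force
  qed (auto simp: left_exts_def dest: L_length)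
  moreover have "inj_on ?f ?S" by (auto simp: inj_on_def)
  ultimately have "card (L (Suc n)) = card ?S" by (simp add: card_image)
  also have "\<dots> = (\<Sum>u\<in>L n. card (left_exts u))"
    by (intro card_SigmaI) (auto intro: finite_subset[OF left_exts_subset])
  finally show ?thesis by (simp add: card_L)
qed

lemma ex_right_special:
  "\<exists>r\<in>L n. right_exts r = {1..k} \<and> (\<forall>u\<in>L n. u \<noteq> r \<longrightarrow> (\<exists>a. right_exts u = {a}))"
proof -
  have "\<exists>r\<in>L n. \<forall>u\<in>L n. u \<noteq> r \<longrightarrow> (\<exists>a. right_exts u = {a})"
  proof (cases "n = 0")
    case False
    then obtain r where r: "r \<in> L n"
      and uniq: "\<And>u. u \<in> L n \<Longrightarrow> right_special x u \<Longrightarrow> u = r"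
      using AR unfolding AR_sequence_def by (metis One_nat_def Suc_leI neq0_conv)
    have "\<exists>a. right_exts u = {a}" if u: "u \<in> L n" "u \<noteq> r" for u
    proof -
      obtain a where a: "a \<in> right_exts u" using right_exts_nonempty[OF u(1)] by blast
      have "b = a" if "b \<in> right_exts u" for b
        using that a u uniq[OF u(1)] False L_length[OF u(1)]
        by (auto simp: right_special_def right_exts_def in_factors_iff) blast
      then show ?thesis using a by blast
    qed
    then show ?thesis using r by blast
  qed simp
  then obtain r where r: "r \<in> L n" and one: "\<forall>u\<in>L n. u \<noteq> r \<longrightarrow> (\<exists>a. right_exts u = {a})"
    by blast
  have "card (right_exts r) = Suc (k - 1)"
    using one by (intro card_branching_point[OF finite_L r _ sum_card_right_exts]) force
  then have "right_exts r = {1..k}"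
    using k2 by (intro card_subset_eq right_exts_subset) auto
  then show ?thesis using r one by blast
qed

lemma ex_left_special:
  "\<exists>r\<in>L n. left_exts r = {1..k} \<and> (\<forall>u\<in>L n. u \<noteq> r \<longrightarrow> (\<exists>a. left_exts u = {a}))"
proof -
  have "\<exists>r\<in>L n. \<forall>u\<in>L n. u \<noteq> r \<longrightarrow> (\<exists>a. left_exts u = {a})"
  proof (cases "n = 0")
    case False
    then obtain r where r: "r \<in> L n"
      and uniq: "\<And>u. u \<in> L n \<Longrightarrow> left_special x u \<Longrightarrow> u = r"
      using AR unfolding AR_sequence_def by (metis One_nat_def Suc_leI neq0_conv)
    have "\<exists>a. left_exts u = {a}" if u: "u \<in> L n" "u \<noteq> r" for u
    proof -
      obtain a where a: "a \<in> left_exts u" using left_exts_nonempty[OF u(1)] by blast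
      have "b = a" if "b \<in> left_exts u" for b
        using that a u uniq[OF u(1)] False L_length[OF u(1)]
        by (auto simp: left_special_def left_exts_def in_factors_iff) blast
      then show ?thesis using a by blast
    qed
    then show ?thesis using r by blast
  qed simp
  then obtain r where r: "r \<in> L n" and one: "\<forall>u\<in>L n. u \<noteq> r \<longrightarrow> (\<exists>a. left_exts u = {a})"
    by blast
  have "card (left_exts r) = Suc (k - 1)"
    using one by (intro card_branching_point[OF finite_L r _ sum_card_left_exts]) force
  then have "left_exts r = {1..k}"
    using k2 by (intro card_subset_eq left_exts_subset) auto
  then show ?thesis using r one by blast
qed

text \<open>
  The right (left) special word of length \<open>n\<close>. For \<open>n = 0\<close> it is the empty word, which falls
  outside \<open>right_special\<close> because \<open>factors\<close> contains nonempty words only.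
\<close>

definition rspecial :: "nat \<Rightarrow> nat list" where
  "rspecial n = (SOME r. r \<in> L n \<and> right_exts r = {1..k} \<and>
     (\<forall>u\<in>L n. u \<noteq> r \<longrightarrow> (\<exists>a. right_exts u = {a})))"

definition lspecial :: "nat \<Rightarrow> nat list" where
  "lspecial n = (SOME r. r \<in> L n \<and> left_exts r = {1..k} \<and>
     (\<forall>u\<in>L n. u \<noteq> r \<longrightarrow> (\<exists>a. left_exts u = {a})))"

lemma rspecial: "rspecial n \<in> L n" "right_exts (rspecial n) = {1..k}"
    "\<And>u. u \<in> L n \<Longrightarrow> u \<noteq> rspecial n \<Longrightarrow> \<exists>a. right_exts u = {a}"
  using someI_ex[OF ex_right_special[of n, unfolded Bex_def]] unfolding rspecial_def by blast+

lemma lspecial: "lspecial n \<in> L n" "left_exts (lspecial n) = {1..k}"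
    "\<And>u. u \<in> L n \<Longrightarrow> u \<noteq> lspecial n \<Longrightarrow> \<exists>a. left_exts u = {a}"
  using someI_ex[OF ex_left_special[of n, unfolded Bex_def]] unfolding lspecial_def by blast+

lemma rspecial_unique: "u \<in> L n \<Longrightarrow> a \<in> right_exts u \<Longrightarrow> b \<in> right_exts u \<Longrightarrow> a \<noteq> b \<Longrightarrow> u = rspecial n"
  using rspecial(3)[of u n] by fastforce

lemma lspecial_unique: "u \<in> L n \<Longrightarrow> a \<in> left_exts u \<Longrightarrow> b \<in> left_exts u \<Longrightarrow> a \<noteq> b \<Longrightarrow> u = lspecial n"
  using lspecial(3)[of u n] by fastforce

lemma length_rspecial [simp]: "length (rspecial n) = n"
  and length_lspecial [simp]: "length (lspecial n) = n"
  using rspecial(1) lspecial(1) L_length by blast+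

lemma rspecial_eqI:
  assumes "u \<in> L n" "right_exts u = {1..k}"
  shows "u = rspecial n"
  using rspecial_unique[of u n 1 2] assms k2 by auto

lemma lspecial_eqI:
  assumes "u \<in> L n" "left_exts u = {1..k}"
  shows "u = lspecial n"
  using lspecial_unique[of u n 1 2] assms k2 by auto

lemma right_exts_Cons: "a # u \<in> L (Suc n) \<Longrightarrow> right_exts (a # u) \<subseteq> right_exts u"
  using L_ConsD[of a "u @ [_]"] by (auto simp: right_exts_def)

lemma left_exts_snoc: "u @ [a] \<in> L (Suc n) \<Longrightarrow> left_exts (u @ [a]) \<subseteq> left_exts u"
  using L_snocD[of "_ # u" a] by (auto simp: left_exts_def)

text \<open>
  A suffix of a right special word is right special, hence is the special word of its length.
\<close>

lemma rspecial_Suc: "\<exists>a. rspecial (Suc n) = a # rspecial n"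
proof -
  obtain a u where au: "rspecial (Suc n) = a # u"
    by (metis length_rspecial length_Suc_conv)
  then have "a # u \<in> L (Suc n)" "right_exts (a # u) = {1..k}"
    using rspecial(1,2)[of "Suc n"] by simp_all
  then have "u \<in> L n" "right_exts u = {1..k}"
    using L_ConsD right_exts_Cons right_exts_subset by blast+
  then show ?thesis using au rspecial_eqI by blast
qed

lemma lspecial_Suc: "\<exists>a. lspecial (Suc n) = lspecial n @ [a]"
proof -
  obtain a u where au: "lspecial (Suc n) = u @ [a]"
    by (metis length_lspecial length_Suc_conv_rev)
  then have "u @ [a] \<in> L (Suc n)" "left_exts (u @ [a]) = {1..k}"
    using lspecial(1,2)[of "Suc n"] by simp_all
  then have "u \<in> L n" "left_exts u = {1..k}"
    using L_snocD left_exts_snoc left_exts_subset by blast+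
  then show ?thesis using au lspecial_eqI by blast
qed


section \<open>Circuits of the Rauzy graph\<close>

text \<open>
  The paths that start and end at the vertex \<open>rspecial m\<close> of the Rauzy graph of order \<open>m\<close> and do not
  visit it in between, spelled out as words \<open>z\<close>. Only the subwords of length \<open>m + 1\<close> (the edges)
  are required to be factors: closure of \<open>L (m + 1)\<close> under reversal then suffices for reversing
  such paths, although nothing is known yet about the reversal of longer factors.
\<close>

definition return_path :: "nat \<Rightarrow> nat list \<Rightarrow> bool" where
  "return_path m z \<longleftrightarrow> m < length z \<and> take m z = rspecial m \<and> drop (length z - m) z = rspecial m \<and>
     (\<forall>s. 0 < s \<longrightarrow> s + m < length z \<longrightarrow> take m (drop s z) \<noteq> rspecial m) \<and>
     (\<forall>s. s + Suc m \<le> length z \<longrightarrow> take (Suc m) (drop s z) \<in> L (Suc m))"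

text \<open>
  All vertices strictly inside the path differ from the special word and so have a single right
  extension. Hence the sequence, once it has taken the first edge, has to follow the path.
\<close>

lemma return_path_forced:
  assumes z: "return_path m z" and i: "W i (Suc m) = take (Suc m) z"
  shows "W i (length z) = z"
proof -
  have "W i s = take s z" if "Suc m \<le> s" "s \<le> length z" for s
    using that
  proof (induction s rule: dec_induct)
    case base
    then show ?case using i by simp
  next
    case (step s)
    define u where "u = W (i + (s - m)) m"
    have IH: "W i s = take s z" using step by simp
    have "u = take m (drop (s - m) (W i s))"
      using step by (subst take_drop_factor_at) (auto simp: u_def)
    also have "\<dots> = take m (drop (s - m) z)"
      using step unfolding IH by (simp add: drop_take)
    finally have u: "u = take m (drop (s - m) z)" .
    have "u \<noteq> rspecial m"
      using z step unfolding u return_path_def by auto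
    moreover have "u \<in> L m" by (simp add: u_def)
    moreover have "u @ [x (i + s)] = W (i + (s - m)) (Suc m)"
      using step by (simp add: u_def factor_at_snoc)
    then have "x (i + s) \<in> right_exts u"
      using W_in_L by (simp add: right_exts_def u_def)
    moreover have "u @ [z ! s] = take (Suc m) (drop (s - m) z)"
      using step unfolding u by (subst take_Suc_conv_app_nth) auto
    then have "z ! s \<in> right_exts u"
      using z step unfolding return_path_def right_exts_def by (simp add: u_def)
    ultimately have "x (i + s) = z ! s"
      using rspecial_unique by blast
    then show ?case
      using step IH by (simp add: factor_at_snoc take_Suc_conv_app_nth)
  qed
  from this[of "length z"] z show ?thesis by (simp add: return_path_def)
qed

text \<open>
  Both paths are read off the sequence at one occurrence of their common first edge, and both stop
  at the first return to the special word.
\<close>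

lemma return_path_unique:
  assumes z: "return_path m z" and z': "return_path m z'"
    and b: "z ! m = z' ! m"
  shows "z = z'"
proof -
  have start: "take (Suc m) y = rspecial m @ [y ! m]" if "return_path m y" for y
    using that by (simp add: return_path_def take_Suc_conv_app_nth)
  have eq: "take (Suc m) z' = take (Suc m) z"
    using start[OF z] start[OF z'] b by simp
  have "take (Suc m) (drop 0 z) \<in> L (Suc m)"
    using z unfolding return_path_def by (metis Suc_leI add_0)
  then obtain i where i: "W i (Suc m) = take (Suc m) z"
    using recurrent[of _ _ 0] by auto
  have W: "W i (length z) = z" "W i (length z') = z'"
    using return_path_forced[OF z i] return_path_forced[OF z'] i eq by simp_all
  \<comment> \<open>The end of a shorter path would be a visit of the special word inside the longer one.\<close>
  have no: "\<not> length y < length y'"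
    if y: "return_path m y" "W i (length y) = y" and y': "return_path m y'" "W i (length y') = y'"
    for y y'
  proof
    assume less: "length y < length y'"
    have len: "m < length y" using y(1) by (simp add: return_path_def)
    have "take m (drop (length y - m) y') = W (i + (length y - m)) m"
      using len less by (subst y'(2)[symmetric]) (simp add: take_drop_factor_at)
    also have "\<dots> = take m (drop (length y - m) (W i (length y)))"
      using len by (subst take_drop_factor_at) auto
    also have "\<dots> = rspecial m"
      using y by (simp add: return_path_def)
    finally show False
      using y'(1) len less by (auto simp: return_path_def)
  qed
  have "length z = length z'"
    using no[OF z W(1) z' W(2)] no[OF z' W(2) z W(1)] by simp
  then show ?thesis using W by metis
qed

section \<open>Reversal and palindromic circuits\<close>

definition reversal_closed :: "nat \<Rightarrow> bool" where
  "reversal_closed n \<longleftrightarrow> (\<forall>u\<in>L n. rev u \<in> L n)"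

definition palindromes :: "nat \<Rightarrow> nat list set" where
  "palindromes n = {u \<in> L n. rev u = u}"

lemma finite_palindromes [simp]: "finite (palindromes n)"
  by (simp add: palindromes_def)

lemma reversal_closed_Suc: "reversal_closed (Suc n) \<Longrightarrow> reversal_closed n"
proof -
  assume c: "reversal_closed (Suc n)"
  have "rev u \<in> L n" if u: "u \<in> L n" for u
  proof -
    obtain a where "u @ [a] \<in> L (Suc n)"
      using right_exts_nonempty[OF u] L_length[OF u] by (auto simp: right_exts_def)
    then have "a # rev u \<in> L (Suc n)" using c by (force simp: reversal_closed_def)
    then show ?thesis by (rule L_ConsD)
  qed
  then show ?thesis by (simp add: reversal_closed_def)
qed

lemma left_exts_rev:
  assumes "reversal_closed (Suc (length u))"
  shows "left_exts (rev u) = right_exts u"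
proof -
  have "v \<in> L (Suc (length u)) \<longleftrightarrow> rev v \<in> L (Suc (length u))" for v
    using assms unfolding reversal_closed_def by (metis rev_rev_ident)
  from this[of "u @ [_]"] show ?thesis by (simp add: left_exts_def right_exts_def)
qed

text \<open>
  Consequently a word that is special on both sides is a palindrome.
\<close>

lemma rev_rspecial:
  assumes "reversal_closed (Suc n)"
  shows "rev (rspecial n) = lspecial n"
  using assms left_exts_rev[of "rspecial n"] rspecial(1,2)[of n] reversal_closed_Suc[OF assms]
  by (intro lspecial_eqI) (auto simp: reversal_closed_def)

text \<open>
  Let the sequence run from an occurrence of \<open>v\<close> until it meets the special word \<open>w\<close>, reading
  \<open>v t\<close>; the circuit is \<open>t\<^sup>R v t\<close>. Because \<open>v\<close> has length at least \<open>m\<close>, each edge of this word lies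
  within \<open>v t\<close> or within \<open>t\<^sup>R v\<close>, and the latter is the reversal of the former.
\<close>

lemma palindrome_centre_of_return_path:
  assumes cl: "reversal_closed (Suc m)" and w: "rspecial m = lspecial m"
    and v: "v \<in> palindromes q" and q: "q = m \<or> q = Suc m" and vw: "v \<noteq> rspecial m"
  shows "\<exists>z D. return_path m z \<and> rev z = z \<and> length z = 2 * D + q \<and> take q (drop D z) = v"
proof -
  have revw: "rev (rspecial m) = rspecial m" using rev_rspecial[OF cl] w by simp
  obtain p where p: "W p q = v" 
    using v recurrent[of v q 0] by (auto simp: palindromes_def)
  \<comment> \<open>In \<open>p + q \<le> j + m\<close> the occurrence of \<open>w\<close> may overlap \<open>v\<close>, but must not end inside it.\<close>
  define P where "P j \<longleftrightarrow> p + q \<le> j + m \<and> W j m = rspecial m" for j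
  obtain j0 where "p + q \<le> j0" "W j0 m = rspecial m"
    using recurrent[OF rspecial(1)] by blast
  then have "P j0" by (simp add: P_def)
  define j where "j = (LEAST j. P j)"
  have "P j" unfolding j_def using \<open>P j0\<close> by (rule LeastI)
  then have j: "p + q \<le> j + m" "W j m = rspecial m" by (simp_all add: P_def)
  have least: "W i m \<noteq> rspecial m" if "p + q \<le> i + m" "i < j" for i
    using that not_less_Least[of i P] by (auto simp: P_def j_def)
  define D where "D = j + m - (p + q)"
  have jD: "j + m = p + q + D" using j by (simp add: D_def)
  define t where "t = W (p + q) D"
  define z where "z = rev t @ v @ t"
  have lv: "length v = q" using p by auto
  have revv: "rev v = v" using v by (simp add: palindromes_def)
  have lt: "length t = D" by (simp add: t_def)
  have lz: "length z = 2 * D + q" by (simp add: z_def lv lt)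
  have revz: "rev z = z" by (simp add: z_def revv)
  have right: "take c (drop s z) = W (p + s - D) c" if "D \<le> s" "s + c \<le> length z" for s c
  proof -
    have "drop s z = drop (s - D) (v @ t)" using that by (simp add: z_def lt)
    also have "v @ t = W p (q + D)" by (simp add: t_def factor_at_add p)
    finally show ?thesis using that lz by (simp add: take_drop_factor_at)
  qed
  have mirror: "take c (drop s z) = rev (take c (drop (length z - s - c) z))"
    if "s + c \<le> length z" for s c
    using take_drop_rev[OF that] revz by simp
  have end_w: "drop (length z - m) z = rspecial m"
  proof -
    have "take m (drop (length z - m) z) = W j m"
      using right[of "length z - m" m] lz jD q by (auto intro!: arg_cong2[where f = W])
    then show ?thesis using j lz q by auto
  qed
  have start_w: "take m z = rspecial m"
    using mirror[of 0 m] end_w revw lz q by auto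
  have len: "m < length z"
  proof (cases "q = m")
    case True
    then have "j \<noteq> p" using p vw j by auto
    then show ?thesis using True jD lz by auto
  qed (use q lz in auto)
  have inner_right: "take m (drop s z) \<noteq> rspecial m"
    if "D + q \<le> s + m" "0 < s" "s + m < length z" "D \<le> s" for s
    using right[of s m] least[of "p + s - D"] that jD lz by auto
  have inner: "take m (drop s z) \<noteq> rspecial m" if s: "0 < s" "s + m < length z" for s
  proof (cases "D + q \<le> s + m \<and> D \<le> s")
    case True
    then show ?thesis using inner_right s by simp
  next
    case False
    have "take m (drop (length z - s - m) z) \<noteq> rspecial m"
      using False s lz q by (intro inner_right) auto
    then show ?thesis using mirror[of s m] s revw by (metis less_imp_le rev_rev_ident)
  qed
  have path: "take (Suc m) (drop s z) \<in> L (Suc m)" if s: "s + Suc m \<le> length z" for s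
  proof (cases "D \<le> s")
    case True
    then show ?thesis using right[OF True s] by simp
  next
    case False
    have "take (Suc m) (drop (length z - s - Suc m) z) \<in> L (Suc m)"
      using False s lz q by (subst right) auto
    then show ?thesis using mirror[OF s] cl by (simp add: reversal_closed_def)
  qed
  have "return_path m z"
    unfolding return_path_def using len start_w end_w inner path by blast
  moreover have "take q (drop D z) = v" by (simp add: z_def lt lv)
  ultimately show ?thesis using revz lz by blast
qed

text \<open>
  Sending a palindrome other than the special word to the letter by which its circuit leaves that
  word is injective: the letter determines the circuit, and the parity of the length of the circuit
  decides whether its centre has length \<open>m\<close> or \<open>m + 1\<close>. Since there are \<open>k\<close> such palindromes and
  \<open>k\<close> letters, every letter is reached.
\<close>

lemma every_return_path_palindromic:
  assumes cl: "reversal_closed (Suc m)" and w: "rspecial m = lspecial m"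
    and card: "card (palindromes m) + card (palindromes (Suc m)) = Suc k"
    and b: "b \<in> {1..k}"
  obtains z where "return_path m z" "rev z = z" "z ! m = b"
proof -
  define V where "V = (palindromes m - {rspecial m}) \<union> palindromes (Suc m)"
  have "\<exists>z D. return_path m z \<and> rev z = z \<and> length z = 2 * D + length v \<and>
      take (length v) (drop D z) = v" if "v \<in> V" for v
  proof (rule palindrome_centre_of_return_path[OF cl w])
    show "v \<in> palindromes (length v)" "length v = m \<or> length v = Suc m"
      using that L_length by (auto simp: V_def palindromes_def)
    show "v \<noteq> rspecial m"
      using that L_length[of v "Suc m"] by (auto simp: V_def palindromes_def)
  qed
  then obtain Z D where Z: "\<And>v. v \<in> V \<Longrightarrow> return_path m (Z v) \<and> rev (Z v) = Z v \<and>
      length (Z v) = 2 * D v + length v \<and> take (length v) (drop (D v) (Z v)) = v"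
    by metis
  have lenV: "length v = m \<or> length v = Suc m" if "v \<in> V" for v
    using that L_length by (auto simp: V_def palindromes_def)
  have "inj_on (\<lambda>v. Z v ! m) V"
  proof (rule inj_onI)
    fix v v' assume v: "v \<in> V" "v' \<in> V" and eq: "Z v ! m = Z v' ! m"
    have "Z v = Z v'" using return_path_unique Z v eq by blast
    then have len: "2 * D v + length v = 2 * D v' + length v'" using Z v by metis
    have "length v = length v'" using lenV[OF v(1)] lenV[OF v(2)] len by presburger
    with len have "D v = D v'" by simp
    then show "v = v'" using Z v \<open>Z v = Z v'\<close> \<open>length v = length v'\<close> by metis
  qed
  then have "card ((\<lambda>v. Z v ! m) ` V) = card V" by (rule card_image)
  also have "\<dots> = k"
  proof -
    have "rspecial m \<in> palindromes m" using rev_rspecial[OF cl] w lspecial(1) by (simp add: palindromes_def)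
    moreover have "palindromes m \<inter> palindromes (Suc m) = {}" by (auto simp: palindromes_def dest!: L_length)
    then have "card V = card (palindromes m - {rspecial m}) + card (palindromes (Suc m))"
      unfolding V_def by (intro card_Un_disjoint) auto
    moreover have "0 < card (palindromes m)" using \<open>rspecial m \<in> palindromes m\<close> by (auto simp: card_gt_0_iff)
    ultimately show ?thesis using card by (simp add: card_Diff_singleton)
  qed
  finally have "card ((\<lambda>v. Z v ! m) ` V) = card {1..k}" by simp
  moreover have "(\<lambda>v. Z v ! m) ` V \<subseteq> {1..k}"
  proof
    fix a assume "a \<in> (\<lambda>v. Z v ! m) ` V"
    then obtain v where v: "v \<in> V" "a = Z v ! m" by blast
    then have rp: "return_path m (Z v)" using Z by blast
    then have "take (Suc m) (drop 0 (Z v)) \<in> L (Suc m)"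
      unfolding return_path_def by (metis Suc_leI add_0)
    moreover have "Z v ! m \<in> set (take (Suc m) (Z v))"
      using rp by (simp add: return_path_def take_Suc_conv_app_nth)
    ultimately show "a \<in> {1..k}" using letters_of_factor v by fastforce
  qed
  ultimately have "(\<lambda>v. Z v ! m) ` V = {1..k}"
    by (intro card_subset_eq) auto
  then obtain v where "v \<in> V" "Z v ! m = b" using b by (metis (no_types, lifting) imageE)
  then show ?thesis using Z[of v] that by metis
qed

text \<open>
  If \<open>a \<noteq> b\<close>, the palindromic circuit \<open>w b \<dots> b w\<close> can never be left: its last edge \<open>b w\<close> is not
  right special, and \<open>b w b\<close> is a factor because \<open>w b\<close> is left special, so the next edge is
  \<open>w b\<close> again. The occurrences of \<open>w\<close> after that are all preceded by \<open>b\<close>, contrary to the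
  recurrence of \<open>a w\<close>.
\<close>

lemma bispecial_ends_agree:
  assumes cl: "reversal_closed (Suc m)" and w: "rspecial m = lspecial m"
    and card: "card (palindromes m) + card (palindromes (Suc m)) = Suc k"
    and a: "rspecial (Suc m) = a # rspecial m" and b: "lspecial (Suc m) = rspecial m @ [b]"
  shows "a = b"
proof (rule ccontr)
  assume "a \<noteq> b"
  let ?w = "rspecial m"
  have wb: "?w @ [b] \<in> L (Suc m)" and aw: "a # ?w \<in> L (Suc m)"
    using lspecial(1)[of "Suc m"] rspecial(1)[of "Suc m"] a b by simp_all
  then have "b \<in> {1..k}" using letters_of_factor by force
  then obtain z where z: "return_path m z" "rev z = z" "z ! m = b"
    using every_return_path_palindromic[OF cl w card] by blast
  define l where "l = length z - m"
  have l: "0 < l" "length z = l + m" using z by (simp_all add: l_def return_path_def)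
  have start: "take (Suc m) z = ?w @ [b]"
    using z by (simp add: return_path_def take_Suc_conv_app_nth)
  have last: "z ! (l - 1) = b"
  proof -
    have "z ! (l - 1) = rev z ! (l - 1)" using z by simp
    also have "\<dots> = z ! m" using l by (subst rev_nth) auto
    finally show ?thesis using z by simp
  qed
  obtain i where i: "W i (Suc m) = ?w @ [b]" using recurrent[OF wb, of 0] by blast
  \<comment> \<open>The sequence is periodic from \<open>i\<close> on, with period \<open>l\<close>, the length of the circuit.\<close>
  have run: "W (i + s * l) (length z) = z" for s
  proof (induction s)
    case 0
    then show ?case using return_path_forced[OF z(1)] i start by simp
  next
    case (Suc s)
    \<comment> \<open>The position of the last edge \<open>b w\<close> of the circuit.\<close>
    define i' where "i' = i + s * l + (l - 1)"
    have i'l: "Suc i' = i + Suc s * l" using l by (simp add: i'_def)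
    have IH: "W (i + s * l) (length z) = z" by (rule Suc)
    have "x i' = z ! (l - 1)"
      using l by (subst IH[symmetric]) (simp add: i'_def)
    then have xi': "x i' = b" using last by simp
    have "W (Suc i') m = take m (drop l (W (i + s * l) (length z)))"
      using i'l by (subst take_drop_factor_at) (simp_all add: l algebra_simps)
    also have "\<dots> = ?w" using z l unfolding IH by (simp add: return_path_def)
    finally have Wi': "W (Suc i') m = ?w" .
    define c where "c = x (Suc i' + m)"
    have Wc: "W (Suc i') (Suc m) = ?w @ [c]"
      by (simp add: factor_at_snoc Wi' c_def)
    have "b # ?w @ [c] \<in> L (Suc (Suc m))"
      using W_in_L[of i' "Suc (Suc m)"] by (simp add: factor_at_Cons[of x i'] xi' Wc)
    moreover obtain e where "right_exts (b # ?w) = {e}"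
    proof (rule exE[OF rspecial(3)])
      show "b # ?w \<in> L (Suc m)"
        using W_in_L[of i' "Suc m"] by (simp add: factor_at_Cons xi' Wi')
    qed (use a \<open>a \<noteq> b\<close> in simp)
    moreover have "b # ?w @ [b] \<in> L (Suc (Suc m))"
      using lspecial(2)[of "Suc m"] \<open>b \<in> {1..k}\<close> unfolding b left_exts_def by auto
    ultimately have "c \<in> {e}" "b \<in> {e}" by (auto simp: right_exts_def)
    then have "c = b" by simp
    then show ?case
      using return_path_forced[OF z(1), of "Suc i'"] Wc start i'l by simp
  qed
  obtain j where j: "i \<le> j" "W j (Suc m) = a # ?w" using recurrent[OF aw] by blast
  then have xj: "x j = a" and Wj: "W (Suc j) m = ?w" by (simp_all add: factor_at_Cons)
  \<comment> \<open>An occurrence of \<open>w\<close> inside a period has to be at its start, so \<open>r = 0\<close>.\<close>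
  define s r where "s = (Suc j - i) div l" and "r = (Suc j - i) mod l"
  have sr: "Suc j = i + s * l + r" "r < l" using j l by (simp_all add: s_def r_def)
  have "take m (drop r (W (i + s * l) (length z))) = ?w"
    using sr l Wj by (simp add: take_drop_factor_at)
  then have "r = 0" using z(1) sr l unfolding run by (auto simp: return_path_def)
  then obtain s' where s': "s = Suc s'" using sr j by (cases s) auto
  then have "x j = W (i + s' * l) (length z) ! (l - 1)"
    using sr \<open>r = 0\<close> l by (auto intro!: arg_cong[where f = x])
  then show False using run last xj \<open>a \<noteq> b\<close> by simp
qed

section \<open>From one length to the next\<close>

text \<open>
  If \<open>u\<close> is not right special, then \<open>a u\<close> is followed by the only letter that can follow \<open>u\<close>;
  the argument is symmetric if \<open>u\<close> is not left special.
\<close>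

lemma two_sided_ext_iff:
  assumes u: "u \<in> L m" and nb: "u \<noteq> rspecial m \<or> u \<noteq> lspecial m"
  shows "a # u @ [b] \<in> L (Suc (Suc m)) \<longleftrightarrow> a \<in> left_exts u \<and> b \<in> right_exts u"
proof
  have [simp]: "length u = m" using u L_length by simp
  show "a # u @ [b] \<in> L (Suc (Suc m)) \<Longrightarrow> a \<in> left_exts u \<and> b \<in> right_exts u"
    using L_snocD[of "a # u" b] L_ConsD[of a "u @ [b]"] by (auto simp: left_exts_def right_exts_def)
  assume ab: "a \<in> left_exts u \<and> b \<in> right_exts u"
  show "a # u @ [b] \<in> L (Suc (Suc m))"
  proof (cases "u = rspecial m")
    case False
    have au: "a # u \<in> L (Suc m)" using ab by (simp add: left_exts_def)
    then obtain c where c: "c \<in> right_exts (a # u)" using right_exts_nonempty by blast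
    then have "c \<in> right_exts u" using right_exts_Cons[OF au] by blast
    then have "c = b" using rspecial_unique[OF u] ab False by blast
    then show ?thesis using c by (simp add: right_exts_def)
  next
    case True
    with nb have nl: "u \<noteq> lspecial m" by simp
    have ub: "u @ [b] \<in> L (Suc m)" using ab by (simp add: right_exts_def)
    then obtain c where c: "c \<in> left_exts (u @ [b])" using left_exts_nonempty by blast
    then have "c \<in> left_exts u" using left_exts_snoc[OF ub] by blast
    then have "c = a" using lspecial_unique[OF u] ab nl by blast
    then show ?thesis using c by (simp add: left_exts_def)
  qed
qed

text \<open>
  The word \<open>c w\<close> takes all right extensions and \<open>w d\<close> all left extensions. If \<open>a \<noteq> c\<close>, then \<open>a w\<close>
  is not right special, and its single right extension is \<open>d\<close>.
\<close>

lemma bispecial_ext_iff: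
  assumes w: "rspecial m = lspecial m"
    and c: "rspecial (Suc m) = c # rspecial m" and d: "lspecial (Suc m) = rspecial m @ [d]"
  shows "a # rspecial m @ [b] \<in> L (Suc (Suc m)) \<longleftrightarrow>
    a \<in> {1..k} \<and> b \<in> {1..k} \<and> (a = c \<or> b = d)"
proof -
  let ?w = "rspecial m"
  have cwb: "c # ?w @ [b] \<in> L (Suc (Suc m)) \<longleftrightarrow> b \<in> {1..k}" for b
    using rspecial(2)[of "Suc m"] unfolding c by (auto simp: right_exts_def)
  have awd: "a # ?w @ [d] \<in> L (Suc (Suc m)) \<longleftrightarrow> a \<in> {1..k}" for a
    using lspecial(2)[of "Suc m"] unfolding d by (auto simp: left_exts_def)
  have letters: "a \<in> {1..k} \<and> b \<in> {1..k}" if "a # ?w @ [b] \<in> L (Suc (Suc m))"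
    using letters_of_factor[OF that] by auto
  have "b = d" if ab: "a # ?w @ [b] \<in> L (Suc (Suc m))" and ac: "a \<noteq> c"
  proof (rule ccontr)
    assume "b \<noteq> d"
    moreover have "a # ?w @ [d] \<in> L (Suc (Suc m))" using awd letters[OF ab] by blast
    moreover have "a # ?w \<in> L (Suc m)" using L_snocD[of "a # ?w" b] ab by simp
    ultimately have "a # ?w = rspecial (Suc m)"
      using ab by (intro rspecial_unique[of _ _ b d]) (auto simp: right_exts_def)
    then show False using c ac by simp
  qed
  then show ?thesis using cwb awd letters by blast
qed

text \<open>
  Both claims rest on the symmetry of the two-sided extensions, which at a word that is special on
  both sides is the equality \<open>c = d\<close>. The palindromes of length \<open>m + 2\<close> correspond to those of
  length \<open>m\<close> by deleting the two outer letters.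
\<close>

lemma reversal_closed_and_card_palindromes_step:
  assumes cl: "reversal_closed (Suc m)"
    and card: "card (palindromes m) + card (palindromes (Suc m)) = Suc k"
  shows "reversal_closed (Suc (Suc m))" "card (palindromes (Suc (Suc m))) = card (palindromes m)"
proof -
  obtain c where c: "rspecial (Suc m) = c # rspecial m" using rspecial_Suc by blast
  obtain d where d: "lspecial (Suc m) = lspecial m @ [d]" using lspecial_Suc by blast
  have cd: "c = d" if "rspecial m = lspecial m"
    using bispecial_ends_agree[OF cl that card c] d that by simp
  have revu: "rev u \<in> L m" if "u \<in> L m" for u
    using reversal_closed_Suc[OF cl] that by (simp add: reversal_closed_def)
  have le: "left_exts (rev u) = right_exts u" if "u \<in> L m" for u
    using left_exts_rev[of u] cl L_length[OF that] by simp
  have ext: "b # rev u @ [a] \<in> L (Suc (Suc m))"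
    if u: "u \<in> L m" and aub: "a # u @ [b] \<in> L (Suc (Suc m))" for a u b
  proof (cases "u = rspecial m \<and> u = lspecial m")
    case True
    then have w: "rspecial m = lspecial m" and uw: "u = rspecial m" "rev u = rspecial m"
      using rev_rspecial[OF cl] by metis+
    show ?thesis
      using aub bispecial_ext_iff[OF w c, of d] d w cd[OF w] uw by auto
  next
    case False
    then have "rev u \<noteq> rspecial m \<or> rev u \<noteq> lspecial m" using rev_rspecial[OF cl] by (metis rev_rev_ident)
    then show ?thesis
      using two_sided_ext_iff[OF u, of a b] two_sided_ext_iff[OF revu[OF u], of b a] False aub
        le[OF u] le[OF revu[OF u]] by auto
  qed
  show "reversal_closed (Suc (Suc m))"
    unfolding reversal_closed_def
  proof
    fix v assume v: "v \<in> L (Suc (Suc m))"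
    then obtain a y where "v = a # y" "length y = Suc m"
      using L_length by (metis length_Suc_conv)
    then obtain u b where vu: "v = a # u @ [b]" by (metis length_Suc_conv_rev)
    then have "u \<in> L m" using v L_ConsD L_snocD by blast
    then show "rev v \<in> L (Suc (Suc m))" using ext v vu by simp
  qed
  have ex1: "\<exists>!a. a # u @ [a] \<in> L (Suc (Suc m))" if u: "u \<in> palindromes m" for u
  proof (cases "u = rspecial m \<and> u = lspecial m")
    case True
    then have w: "rspecial m = lspecial m" by metis
    have "c \<in> {1..k}" using rspecial(1)[of "Suc m"] letters_of_factor unfolding c by force
    then show ?thesis
      using bispecial_ext_iff[OF w c, of d] d w cd[OF w] True by auto
  next
    case False
    have uL: "u \<in> L m" and ru: "rev u = u" using u by (simp_all add: palindromes_def)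
    then have "u \<noteq> rspecial m" using False rev_rspecial[OF cl] by metis
    then obtain a where "right_exts u = {a}" using rspecial(3) uL by blast
    then show ?thesis
      using two_sided_ext_iff[OF uL] False le[OF uL] ru by auto
  qed
  define f where "f u = (THE a. a # u @ [a] \<in> L (Suc (Suc m)))" for u
  have f: "a # u @ [a] \<in> L (Suc (Suc m)) \<longleftrightarrow> a = f u" if "u \<in> palindromes m" for a u
    using theI'[OF ex1[OF that]] ex1[OF that] unfolding f_def by blast
  have "palindromes (Suc (Suc m)) = (\<lambda>u. f u # u @ [f u]) ` palindromes m"
  proof (intro equalityI subsetI)
    fix v assume v: "v \<in> palindromes (Suc (Suc m))"
    then obtain a y where "v = a # y" "length y = Suc m"
      using L_length unfolding palindromes_def by (metis (no_types, lifting) mem_Collect_eq length_Suc_conv)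
    then obtain u b where vu: "v = a # u @ [b]" by (metis length_Suc_conv_rev)
    have vL: "a # u @ [b] \<in> L (Suc (Suc m))" and rv: "rev (a # u @ [b]) = a # u @ [b]"
      using v unfolding vu palindromes_def by blast+
    have "b = a" "rev u = u"
      using arg_cong[OF rv, of hd] arg_cong[OF rv, of "\<lambda>v. butlast (tl v)"] by simp_all
    moreover have "u \<in> L m" using L_snocD[OF L_ConsD[OF vL]] .
    ultimately show "v \<in> (\<lambda>u. f u # u @ [f u]) ` palindromes m"
      using f[of u a] vL unfolding vu palindromes_def by blast
  next
    fix v assume "v \<in> (\<lambda>u. f u # u @ [f u]) ` palindromes m"
    then show "v \<in> palindromes (Suc (Suc m))" using f by (auto simp: palindromes_def)
  qed
  moreover have "inj_on (\<lambda>u. f u # u @ [f u]) (palindromes m)" by (auto simp: inj_on_def)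
  ultimately show "card (palindromes (Suc (Suc m))) = card (palindromes m)" by (simp add: card_image)
qed

lemma rev_of_letter: "u \<in> L (Suc 0) \<Longrightarrow> rev u = u"
  using L_length[of u "Suc 0"] by (auto simp: length_Suc_conv)

lemma reversal_closed_and_card_palindromes:
  "reversal_closed (Suc m) \<and> card (palindromes m) = (if odd m then k else 1) \<and>
   card (palindromes (Suc m)) = (if odd (Suc m) then k else 1)"
proof (induction m)
  case 0
  have "palindromes 0 = {[]}" "palindromes (Suc 0) = L (Suc 0)" using rev_of_letter by (auto simp: palindromes_def)
  then show ?case using card_L[of "Suc 0"] k2 rev_of_letter by (auto simp: reversal_closed_def)
next
  case (Suc m)
  then have "card (palindromes m) + card (palindromes (Suc m)) = Suc k" by auto
  then show ?case using Suc reversal_closed_and_card_palindromes_step[of m] by auto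
qed

end

section \<open>Sequences over arbitrary positions\<close>

lemma factors_of_length_nonneg:
  fixes x :: "'i::semiring_1 \<Rightarrow> nat"
  assumes "uniformly_recurrent x"
  shows "factors_of_length (\<lambda>n::nat. x (of_nat n)) n = factors_of_length x n"
proof -
  have shift: "factor_at (\<lambda>n::nat. x (of_nat n)) i n = factor_at x (of_nat i) n" for i n
    by (simp add: factor_at_def)
  have "factor_at x i n \<in> factors_of_length (\<lambda>n::nat. x (of_nat n)) n" for i
  proof (cases "n = 0")
    case False
    then have "factor_at x i n \<in> factors x"
      by (auto simp: factors_def factors_of_length_def Suc_le_eq intro!: bexI[of _ n])
    then obtain j where "factor_at x (0 + of_nat j) n = factor_at x i n"
      using assms unfolding uniformly_recurrent_def by (metis length_factor_at)
    then have "factor_at x (of_nat j) n = factor_at x i n" by simp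
    then show ?thesis unfolding factors_of_length_def shift by (metis rangeI)
  qed (simp add: factors_of_length_def)
  then show ?thesis by (auto simp: factors_of_length_def shift)
qed

text \<open>
  All conditions of \<open>AR_sequence\<close> except uniform recurrence speak of the language, which is
  unchanged by the restriction; the bound on the gaps is inherited.
\<close>

lemma AR_sequence_nonneg:
  fixes x :: "'i::semiring_1 \<Rightarrow> nat"
  assumes "AR_sequence k x"
  shows "AR_sequence k (\<lambda>n::nat. x (of_nat n))"
proof -
  let ?y = "\<lambda>n::nat. x (of_nat n)"
  have ur: "uniformly_recurrent x" using assms by (simp add: AR_sequence_def)
  note F = factors_of_length_nonneg[OF ur]
  have fac: "factors ?y = factors x" by (simp add: factors_def F)
  have shift: "factor_at ?y i n = factor_at x (of_nat i) n" for i n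
    by (simp add: factor_at_def)
  have "uniformly_recurrent ?y"
    unfolding uniformly_recurrent_def fac
  proof
    fix u assume "u \<in> factors x"
    then obtain N where "\<And>i. \<exists>j<N. factor_at x (i + of_nat j) (length u) = u"
      using ur unfolding uniformly_recurrent_def by blast
    then have "\<exists>j<N. factor_at x (of_nat (i + j)) (length u) = u" for i
      by (simp only: of_nat_add)
    then show "\<exists>N. \<forall>i. \<exists>j<N. factor_at ?y (i + of_nat j) (length u) = u"
      unfolding shift of_nat_id by blast
  qed
  moreover have "?y \<in> sequences k" using assms by (simp add: AR_sequence_def sequences_def)
  moreover have "right_special ?y = right_special x" "left_special ?y = left_special x"
    by (simp_all add: fun_eq_iff right_special_def left_special_def fac)
  ultimately show ?thesis using assms unfolding AR_sequence_def F by simp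
qed

lemma palindrome_complexity_AR_subshift:
  fixes X :: "('i::semiring_1 \<Rightarrow> nat) set"
  assumes k: "2 \<le> k" and X: "AR_subshift k X" and n: "1 \<le> n"
  shows "palindrome_complexity X n = (if odd n then k else 1)"
proof -
  obtain x :: "'i \<Rightarrow> nat" where x: "AR_sequence k x"
    and Xx: "X = {y \<in> sequences k. \<forall>n\<ge>1. factors_of_length y n = factors_of_length x n}"
    using X by (auto simp: AR_subshift_def)
  interpret arnoux_rauzy "\<lambda>n::nat. x (of_nat n)" k
    using k AR_sequence_nonneg[OF x] by unfold_locales
  have ur: "uniformly_recurrent x" and "x \<in> sequences k" using x by (simp_all add: AR_sequence_def)
  then have "x \<in> X" by (simp add: Xx)
  moreover have "factors y = factors x" if "y \<in> X" for y
    using that by (auto simp: Xx factors_def)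
  ultimately have "subshift_factors X = factors x" unfolding subshift_factors_def by blast
  moreover have "u \<in> factors x \<and> length u = n \<longleftrightarrow> u \<in> factors_of_length x n" for u
    using n by (auto simp: factors_def factors_of_length_def)
  ultimately have "{u \<in> subshift_factors X. palindrome u \<and> length u = n} = palindromes n"
    by (auto simp: palindromes_def palindrome_def factors_of_length_nonneg[OF ur])
  then show ?thesis using reversal_closed_and_card_palindromes[of n] by (simp add: palindrome_complexity_def)
qed

theorem theorem5p1:
  fixes k :: nat
  assumes "k \<ge> 2"
  shows "(\<forall>X :: (nat \<Rightarrow> nat) set. AR_subshift k X \<longrightarrow>
            (\<forall>n\<ge>1. palindrome_complexity X n = (if odd n then k else 1))) \<and>
         (\<forall>X :: (int \<Rightarrow> nat) set. AR_subshift k X \<longrightarrow>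
            (\<forall>n\<ge>1. palindrome_complexity X n = (if odd n then k else 1)))"
  by (intro conjI allI impI palindrome_complexity_AR_subshift[OF assms])

end
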